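(* Every symmetric Leibniz algebra $\mathfrak{L}$ over a field is flexible and power-associative. Moreover, $x^3=0$ for every element $x\in\mathfrak{L}$.
   Context: An algebra over a field is a vector space with a bilinear multiplication $(x,y)\mapsto xy$, not assumed associative. A symmetric Leibniz algebra is an algebra $\mathfrak{L}$ satisfying both $x(yz)=(xy)z+y(xz)$ and $(xy)z=(xz)y+x(yz)$ for all $x,y,z\in\mathfrak{L}$. An algebra is flexible if $x(yx)=(xy)x$ for all elements $x,y$. An algebra is power-associative if every subalgebra generated by one element is associative; in that case powers are defined by $x^1:=x$ and $x^{n+1}:=xx^n$ for every positive integer $n$. *)

theory Defs
  imports Complex_Main
begin

text \<open>
  The underlying vector space is the whole type \<open>'a\<close>, with scalars in an arbitrary field
  \<open>'k\<close> acting by \<open>scale\<close>. The multiplication is an arbitrary bilinear map, so it is a parameter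
  and not the class operation \<open>(*)\<close>.
\<close>

locale nonassoc_algebra = vector_space scale
  for scale :: "'k::field \<Rightarrow> 'a::ab_group_add \<Rightarrow> 'a" +
  fixes mult :: "'a \<Rightarrow> 'a \<Rightarrow> 'a"
  assumes linear_mult_left: "Vector_Spaces.linear scale scale (\<lambda>x. mult x y)"
    and linear_mult_right: "Vector_Spaces.linear scale scale (\<lambda>y. mult x y)"

locale symmetric_leibniz_algebra = nonassoc_algebra scale mult
  for scale :: "'k::field \<Rightarrow> 'a::ab_group_add \<Rightarrow> 'a" and mult :: "'a \<Rightarrow> 'a \<Rightarrow> 'a" +
  assumes left_leibniz: "mult x (mult y z) = mult (mult x y) z + mult y (mult x z)"
    and right_leibniz: "mult (mult x y) z = mult (mult x z) y + mult x (mult y z)"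

definition flexible :: "('a \<Rightarrow> 'a \<Rightarrow> 'a) \<Rightarrow> bool" where
  "flexible mult \<longleftrightarrow> (\<forall>x y. mult x (mult y x) = mult (mult x y) x)"

definition subalgebra ::
  "('k::field \<Rightarrow> 'a::ab_group_add \<Rightarrow> 'a) \<Rightarrow> ('a \<Rightarrow> 'a \<Rightarrow> 'a) \<Rightarrow> 'a set \<Rightarrow> bool" where
  "subalgebra scale mult S \<longleftrightarrow>
     module.subspace scale S \<and> (\<forall>x\<in>S. \<forall>y\<in>S. mult x y \<in> S)"

definition associative_on :: "('a \<Rightarrow> 'a \<Rightarrow> 'a) \<Rightarrow> 'a set \<Rightarrow> bool" where
  "associative_on mult S \<longleftrightarrow>
     (\<forall>x\<in>S. \<forall>y\<in>S. \<forall>z\<in>S. mult (mult x y) z = mult x (mult y z))"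

definition power_associative ::
  "('k::field \<Rightarrow> 'a::ab_group_add \<Rightarrow> 'a) \<Rightarrow> ('a \<Rightarrow> 'a \<Rightarrow> 'a) \<Rightarrow> bool" where
  "power_associative scale mult \<longleftrightarrow>
     (\<forall>x. associative_on mult (subalgebra scale mult hull {x}))"

text \<open>
  Powers exist for positive exponents only (there is no unit); the value at exponent \<open>0\<close> is
  deliberately left unspecified.
\<close>

fun alg_power :: "('a \<Rightarrow> 'a \<Rightarrow> 'a) \<Rightarrow> 'a \<Rightarrow> nat \<Rightarrow> 'a" where
  "alg_power mult x (Suc 0) = x"
| "alg_power mult x (Suc (Suc n)) = mult x (alg_power mult x (Suc n))"

end

theory Submission
  imports Defs
begin

text \<open>
  Setting two arguments equal in each Leibniz identity makes every square annihilate the algebra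
  from both sides. Hence \<open>x\<^sup>3 = 0\<close>, flexibility is the left identity with its last term removed,
  and the subalgebra generated by \<open>x\<close> is the span of \<open>x\<close> and \<open>x\<^sup>2\<close>. Its products are multiples
  of \<open>x\<^sup>2\<close>, so all its triple products vanish.
\<close>

context nonassoc_algebra
begin

lemma mult_add_left: "mult (x + y) z = mult x z + mult y z"
  and mult_scale_left: "mult (scale a x) z = scale a (mult x z)"
  using linear_mult_left[of z] by (simp_all add: linear_iff_module_hom module_hom_iff)

lemma mult_add_right: "mult z (x + y) = mult z x + mult z y"
  and mult_scale_right: "mult z (scale a x) = scale a (mult z x)"
  using linear_mult_right[of z] by (simp_all add: linear_iff_module_hom module_hom_iff)

end

context symmetric_leibniz_algebra
begin

lemma square_mult [simp]: "mult (mult x x) y = 0"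
  \<comment> \<open>Here \<open>mult x (mult x y)\<close> stands on both sides and cancels.\<close>
  using left_leibniz[of x x y] by simp

lemma mult_square [simp]: "mult y (mult x x) = 0"
  using right_leibniz[of y x x] by simp

lemma flexible_mult: "flexible mult"
  unfolding flexible_def using left_leibniz[of x y x for x y] by simp

lemma alg_power_3: "alg_power mult x 3 = 0"
  by (simp add: numeral_3_eq_3)

lemma mult_span_square:
  assumes "u \<in> span {x, mult x x}" "v \<in> span {x, mult x x}"
  obtains a where "mult u v = scale a (mult x x)"
proof -
  obtain a b c d where "u = scale a x + scale b (mult x x)" "v = scale c x + scale d (mult x x)"
    \<comment> \<open>\<open>span_insert\<close> puts \<open>u - scale a x\<close> in the span of
      \<open>mult x x\<close>; \<open>algebra_simps\<close> moves \<open>scale a x\<close>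
      across.\<close>
    using assms by (auto simp: span_insert span_singleton algebra_simps)
  \<comment> \<open>Of the four products in the expansion, three have the factor
    \<open>mult x x\<close> and vanish.\<close>
  then have "mult u v = scale (c * a) (mult x x)"
    by (simp add: mult_add_left mult_scale_left mult_add_right mult_scale_right)
  then show thesis by (rule that)
qed

lemma subalgebra_span_square: "subalgebra scale mult (span {x, mult x x})"
  unfolding subalgebra_def
proof (intro conjI ballI subspace_span)
  fix u v assume "u \<in> span {x, mult x x}" "v \<in> span {x, mult x x}"
  then obtain a where "mult u v = scale a (mult x x)"
    by (rule mult_span_square)
  then show "mult u v \<in> span {x, mult x x}"
    by (simp add: span_base span_scale)
qed

lemma associative_on_span_square: "associative_on mult (span {x, mult x x})"
  unfolding associative_on_def
proof (intro ballI)
  fix u v w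
  assume "u \<in> span {x, mult x x}" "v \<in> span {x, mult x x}" "w \<in> span {x, mult x x}"
  then obtain a b where "mult u v = scale a (mult x x)" "mult v w = scale b (mult x x)"
    by (metis mult_span_square)
  \<comment> \<open>Each side is a multiple of a product with the factor \<open>mult x x\<close>,
    hence 0.\<close>
  then show "mult (mult u v) w = mult u (mult v w)"
    by (simp add: mult_scale_left mult_scale_right)
qed

lemma power_associative_mult: "power_associative scale mult"
  unfolding power_associative_def
proof
  fix x
  \<comment> \<open>Associativity passes to subsets, so bounding the hull from above
    suffices.\<close>
  have "subalgebra scale mult hull {x} \<subseteq> span {x, mult x x}"
    by (intro hull_minimal subalgebra_span_square) (simp add: span_base)
  then show "associative_on mult (subalgebra scale mult hull {x})"
    using associative_on_span_square[of x] unfolding associative_on_def by blast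
qed

end

theorem proposition2p17:
  fixes scale :: "'k::field \<Rightarrow> 'a::ab_group_add \<Rightarrow> 'a"
    and mult :: "'a \<Rightarrow> 'a \<Rightarrow> 'a"
  assumes "symmetric_leibniz_algebra scale mult"
  shows "flexible mult \<and> power_associative scale mult \<and> (\<forall>x. alg_power mult x 3 = 0)"
proof -
  interpret symmetric_leibniz_algebra scale mult by fact
  show ?thesis
    using flexible_mult power_associative_mult alg_power_3 by blast
qed

end
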